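(* Let $(X,\mathcal{A})$ be a measurable space and let $S(X,\mathcal{A})$ be a $\chi$-ring. Let $\mathcal{M}_S$ be the set of all maximal ideals of $S(X,\mathcal{A})$ and $\mathcal{U}(X)$ the set of all $\mathcal{A}$-ultrafilters on $X$. Then the map $\mathcal{M}_S\to\mathcal{U}(X)$, $M\mapsto\mathcal{Z}_S[M]$, is one-to-one if and only if $S(X,\mathcal{A})$ is a Gelfand ring.
   Context: A measurable space $(X,\mathcal{A})$ is a nonempty set $X$ with a $\sigma$-algebra $\mathcal{A}$ of subsets of $X$. $\mathcal{M}(X,\mathcal{A})$ is the commutative ring (pointwise operations) of all $\mathcal{A}$-measurable functions $X\to\mathbb{R}$. A $\chi$-ring $S(X,\mathcal{A})$ is a subring of $\mathcal{M}(X,\mathcal{A})$ such that $\chi_A\in S(X,\mathcal{A})$ for every $A\in\mathcal{A}$, where $\chi_A$ is the characteristic function of $A$. "Ideal" always means proper ideal. For $f\in S(X,\mathcal{A})$, $\mathcal{Z}_S(f)=\{E\in\mathcal{A}: \text{there exists } g\in S(X,\mathcal{A}) \text{ with } f(x)g(x)=1 \text{ for all } x\in X\setminus E\}$; for an ideal $I$, $\mathcal{Z}_S[I]=\bigcup_{f\in I}\mathcal{Z}_S(f)$. An $\mathcal{A}$-filter on $X$ is a nonempty family of members of $\mathcal{A}$ not containing $\emptyset$, closed under finite intersections and under supersets belonging to $\mathcal{A}$; an $\mathcal{A}$-ultrafilter is a maximal $\mathcal{A}$-filter. For every maximal ideal $M$ of $S(X,\mathcal{A})$, $\mathcal{Z}_S[M]$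 is an $\mathcal{A}$-ultrafilter, so the map is well defined. A commutative ring with unity is Gelfand if every prime ideal is contained in a unique maximal ideal. *)

theory Defs
  imports "HOL-Analysis.Borel_Space" "HOL-Algebra.Subrings" "HOL-Algebra.Ideal"
begin

text \<open>
  A measurable space is given by \<open>X :: 'a measure\<close>, of which only \<open>space X\<close> and \<open>sets X\<close>
  are used. A function on \<open>space X\<close> is represented by its extensional extension
  to the whole type, so that equality in the ring below is equality on \<open>space X\<close>.
\<close>

definition measurable_fun_ring :: "'a measure \<Rightarrow> ('a \<Rightarrow> real) ring" where
  "measurable_fun_ring X =
    \<lparr>carrier = borel_measurable X \<inter> extensional (space X),
     mult = (\<lambda>f g. \<lambda>x\<in>space X. f x * g x),
     one = (\<lambda>x\<in>space X. 1),
     zero = (\<lambda>x\<in>space X. 0),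
     add = (\<lambda>f g. \<lambda>x\<in>space X. f x + g x)\<rparr>"

lemma measurable_fun_ring_cring: "cring (measurable_fun_ring X)"
proof (rule cringI)
  show "abelian_group (measurable_fun_ring X)"
  proof (rule abelian_groupI)
    fix f assume f: "f \<in> carrier (measurable_fun_ring X)"
    let ?g = "\<lambda>x\<in>space X. - f x"
    have "?g \<in> carrier (measurable_fun_ring X)"
      using f by (auto simp: measurable_fun_ring_def cong: measurable_cong)
    moreover have "?g \<oplus>\<^bsub>measurable_fun_ring X\<^esub> f = \<zero>\<^bsub>measurable_fun_ring X\<^esub>"
      by (auto simp: measurable_fun_ring_def)
    ultimately show "\<exists>g\<in>carrier (measurable_fun_ring X).
        g \<oplus>\<^bsub>measurable_fun_ring X\<^esub> f = \<zero>\<^bsub>measurable_fun_ring X\<^esub>" by blast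
  qed (auto simp: measurable_fun_ring_def fun_eq_iff extensional_def cong: measurable_cong)
  show "Group.comm_monoid (measurable_fun_ring X)"
    by (rule comm_monoidI)
      (auto simp: measurable_fun_ring_def fun_eq_iff extensional_def cong: measurable_cong)
qed (auto simp: measurable_fun_ring_def fun_eq_iff algebra_simps)

definition char_fun :: "'a measure \<Rightarrow> 'a set \<Rightarrow> 'a \<Rightarrow> real" where
  "char_fun X A = (\<lambda>x\<in>space X. indicator A x)"

definition chi_ring :: "'a measure \<Rightarrow> ('a \<Rightarrow> real) set \<Rightarrow> bool" where
  "chi_ring X S \<longleftrightarrow> subring S (measurable_fun_ring X) \<and> (\<forall>A\<in>sets X. char_fun X A \<in> S)"

text \<open>The subring \<open>S\<close> as a ring in its own right.\<close>

abbreviation ring_on :: "'a measure \<Rightarrow> ('a \<Rightarrow> real) set \<Rightarrow> ('a \<Rightarrow> real) ring" where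
  "ring_on X S \<equiv> (measurable_fun_ring X)\<lparr>carrier := S\<rparr>"

definition zero_family :: "'a measure \<Rightarrow> ('a \<Rightarrow> real) set \<Rightarrow> ('a \<Rightarrow> real) \<Rightarrow> 'a set set" where
  "zero_family X S f = {E \<in> sets X. \<exists>g\<in>S. \<forall>x\<in>space X - E. f x * g x = 1}"

definition zero_family_ideal ::
    "'a measure \<Rightarrow> ('a \<Rightarrow> real) set \<Rightarrow> ('a \<Rightarrow> real) set \<Rightarrow> 'a set set" where
  "zero_family_ideal X S I = (\<Union>f\<in>I. zero_family X S f)"

definition sets_filter :: "'a measure \<Rightarrow> 'a set set \<Rightarrow> bool" where
  "sets_filter X F \<longleftrightarrow> F \<noteq> {} \<and> F \<subseteq> sets X \<and> {} \<notin> F \<and>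
     (\<forall>A\<in>F. \<forall>B\<in>F. A \<inter> B \<in> F) \<and>
     (\<forall>A\<in>F. \<forall>B\<in>sets X. A \<subseteq> B \<longrightarrow> B \<in> F)"

definition sets_ultrafilter :: "'a measure \<Rightarrow> 'a set set \<Rightarrow> bool" where
  "sets_ultrafilter X F \<longleftrightarrow> sets_filter X F \<and>
     (\<forall>G. sets_filter X G \<longrightarrow> F \<subseteq> G \<longrightarrow> G = F)"

text \<open>The library's \<^const>\<open>primeideal\<close> and \<^const>\<open>maximalideal\<close> are proper by definition.\<close>

definition gelfand_ring :: "('a, 'b) ring_scheme \<Rightarrow> bool" where
  "gelfand_ring R \<longleftrightarrow> cring R \<and>
     (\<forall>P. primeideal P R \<longrightarrow> (\<exists>!M. maximalideal M R \<and> P \<subseteq> M))"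

end

theory Submission
  imports Defs "HOL-Algebra.Ring_Divisibility"
begin

text \<open>
  For an ideal \<open>I\<close>, a measurable \<open>E\<close> lies in \<open>Z\<^sub>S[I]\<close> iff \<open>\<chi>\<close> of its complement lies in \<open>I\<close>.
  Hence \<open>Z\<^sub>S[P]\<close> is already an ultrafilter when \<open>P\<close> is merely prime, and then
  \<open>Z\<^sub>S[P] = Z\<^sub>S[M]\<close> for every maximal \<open>M \<supseteq> P\<close>; so injectivity implies the Gelfand property.
  Conversely, if \<open>Z\<^sub>S[M] = Z\<^sub>S[N] = U\<close>, then the functions whose zero set belongs to \<open>U\<close> form a
  prime ideal contained in both \<open>M\<close> and \<open>N\<close>.
\<close>

section \<open>Existence of maximal ideals\<close>

lemma (in ring) proper_ideal_in_maximalideal: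
  assumes I: "ideal I R" "\<one> \<notin> I"
  obtains M where "maximalideal M R" "I \<subseteq> M"
proof -
  \<comment> \<open>Properness is expressed as the absence of \<open>\<one>\<close>, a condition
    that survives unions of chains, as Zorn's lemma requires.\<close>
  let ?A = "{J. ideal J R \<and> I \<subseteq> J \<and> \<one> \<notin> J}"
  have "\<exists>M\<in>?A. \<forall>J\<in>?A. M \<subseteq> J \<longrightarrow> J = M"
  proof (rule subset_Zorn_nonempty)
    show "?A \<noteq> {}" using I by blast
  next
    fix C assume C: "C \<noteq> {}" "subset.chain ?A C"
    then have "subset.chain {J. ideal J R} C"
      unfolding pred_on.chain_def by auto
    from chain_Union_is_ideal[OF this] C show "\<Union>C \<in> ?A"
      unfolding pred_on.chain_def by auto
  qed
  then obtain M where "M \<in> ?A" and max: "\<forall>J\<in>?A. M \<subseteq> J \<longrightarrow> J = M"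
    by (rule bexE)
  then have M: "ideal M R" "I \<subseteq> M" "\<one> \<notin> M" by simp_all
  have "maximalideal M R"
  proof (rule maximalidealI[OF M(1)])
    show "carrier R \<noteq> M" using M(3) by auto
    fix J assume J: "ideal J R" "M \<subseteq> J"
    then show "J = M \<or> J = carrier R"
      using max M(2) ideal.one_imp_carrier[OF J(1)] by auto
  qed
  with M(2) that show thesis by blast
qed

lemma (in cring) prime_ideal_in_maximalideal:
  assumes "primeideal P R"
  obtains M where "maximalideal M R" "P \<subseteq> M"
proof -
  interpret P: primeideal P R by fact
  have "\<one> \<notin> P" using P.I_notcarr P.one_imp_carrier by blast
  with P.is_ideal show thesis using proper_ideal_in_maximalideal that by blast
qed

text \<open>For an ultrafilter \<open>U\<close> this is the trace on \<open>S\<close> of the maximal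
  ideal attached to \<open>U\<close> in the ring of all measurable functions. In \<open>S\<close> it
  is still prime, but it may fail to be maximal: the integers, as constant functions on a point, are
  an example.\<close>

definition vanishing_ideal :: "'a measure \<Rightarrow> ('a \<Rightarrow> real) set \<Rightarrow> 'a set set \<Rightarrow> ('a \<Rightarrow> real) set" where
  "vanishing_ideal X S U = {f \<in> S. {x \<in> space X. f x = 0} \<in> U}"

lemma measurable_fun_ring_simps:
  "f \<otimes>\<^bsub>measurable_fun_ring X\<^esub> g = (\<lambda>x\<in>space X. f x * g x)"
  "f \<oplus>\<^bsub>measurable_fun_ring X\<^esub> g = (\<lambda>x\<in>space X. f x + g x)"
  "\<zero>\<^bsub>measurable_fun_ring X\<^esub> = (\<lambda>x\<in>space X. 0)"
  "\<one>\<^bsub>measurable_fun_ring X\<^esub> = (\<lambda>x\<in>space X. 1)"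
  by (simp_all add: measurable_fun_ring_def)

lemma sets_ultrafilter_is_filter: "sets_ultrafilter X U \<Longrightarrow> sets_filter X U"
  by (simp add: sets_ultrafilter_def)

lemma sets_filter_Int: "sets_filter X F \<Longrightarrow> A \<in> F \<Longrightarrow> B \<in> F \<Longrightarrow> A \<inter> B \<in> F"
  by (simp add: sets_filter_def)

lemma sets_filter_mono: "sets_filter X F \<Longrightarrow> A \<in> F \<Longrightarrow> B \<in> sets X \<Longrightarrow> A \<subseteq> B \<Longrightarrow> B \<in> F"
  by (simp add: sets_filter_def)

lemma sets_filter_space: "sets_filter X F \<Longrightarrow> space X \<in> F"
  unfolding sets_filter_def using sets.sets_into_space by blast

section \<open>The chi-ring and the characteristic functions in its ideals\<close>

context
  fixes X :: "'a measure" and S :: "('a \<Rightarrow> real) set"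
  assumes chi: "chi_ring X S"
begin

lemma chi_ring_cring: "cring (ring_on X S)"
proof -
  interpret M: cring "measurable_fun_ring X" by (rule measurable_fun_ring_cring)
  have S: "subring S (measurable_fun_ring X)" using chi by (simp add: chi_ring_def)
  show ?thesis
  proof (rule cring.intro)
    show "ring (ring_on X S)" by (rule M.subring_is_ring[OF S])
    show "Group.comm_monoid (ring_on X S)"
      using M.subring_is_ring[OF S] subringE(1)[OF S] M.m_comm
      by (auto simp: comm_monoid_def comm_monoid_axioms_def ring_def)
  qed
qed

interpretation R: cring "ring_on X S" by (rule chi_ring_cring)

lemma char_fun_in: "A \<in> sets X \<Longrightarrow> char_fun X A \<in> S"
  using chi by (simp add: chi_ring_def)

lemma chi_ring_zero_set: "f \<in> S \<Longrightarrow> {x \<in> space X. f x = 0} \<in> sets X"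
proof -
  assume "f \<in> S"
  then have "f \<in> borel_measurable X"
    using chi subringE(1) by (force simp: chi_ring_def measurable_fun_ring_def)
  then show ?thesis by measurable
qed

lemma chi_ring_extensional: "f \<in> S \<Longrightarrow> f \<in> extensional (space X)"
  using chi subringE(1) by (force simp: chi_ring_def measurable_fun_ring_def)

text \<open>Together with closure under unions, this makes the measurable sets whose characteristic
  function lies in \<open>I\<close> an ideal of sets. Passing to complements will turn it into a
  filter.\<close>

lemma ideal_char_fun_mono:
  assumes I: "ideal I (ring_on X S)" and A: "A \<in> sets X" "A \<subseteq> B" and B: "char_fun X B \<in> I"
  shows "char_fun X A \<in> I"
proof -
  have "char_fun X A = char_fun X A \<otimes>\<^bsub>ring_on X S\<^esub> char_fun X B"
    using A(2) by (auto simp: measurable_fun_ring_simps char_fun_def fun_eq_iff indicator_def)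
  with ideal.I_l_closed[OF I B, of "char_fun X A"] char_fun_in[OF A(1)] show ?thesis by simp
qed

lemma ideal_char_fun_Un:
  assumes I: "ideal I (ring_on X S)" and sets: "A \<in> sets X" "B \<in> sets X"
    and "char_fun X A \<in> I" "char_fun X B \<in> I"
  shows "char_fun X (A \<union> B) \<in> I"
proof -
  \<comment> \<open>Removing \<open>A\<close> makes the two sets disjoint, so that their
    characteristic functions add up to that of the union.\<close>
  have "char_fun X (B - A) \<in> I"
    using ideal_char_fun_mono[OF I _ _ assms(5)] sets by blast
  then have "char_fun X A \<oplus>\<^bsub>ring_on X S\<^esub> char_fun X (B - A) \<in> I"
    using assms(4) additive_subgroup.a_closed[OF ideal.axioms(1)[OF I]] by blast
  moreover have "char_fun X A \<oplus>\<^bsub>ring_on X S\<^esub> char_fun X (B - A) = char_fun X (A \<union> B)"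
    by (auto simp: measurable_fun_ring_simps char_fun_def fun_eq_iff indicator_def)
  ultimately show ?thesis by simp
qed

text \<open>If \<open>g\<close> inverts \<open>f\<close> outside \<open>E\<close>, multiplying
  \<open>f g\<close> by the characteristic function of the complement erases the unknown values on
  \<open>E\<close> and leaves that characteristic function. Conversely, the latter is its own
  inverse outside \<open>E\<close>.\<close>

lemma zero_family_ideal_iff:
  assumes I: "ideal I (ring_on X S)"
  shows "E \<in> zero_family_ideal X S I \<longleftrightarrow> E \<in> sets X \<and> char_fun X (space X - E) \<in> I"
proof
  assume "E \<in> zero_family_ideal X S I"
  then obtain f g where f: "f \<in> I" and E: "E \<in> sets X" and g: "g \<in> S"
    and fg: "\<And>x. x \<in> space X - E \<Longrightarrow> f x * g x = 1"
    by (auto simp: zero_family_ideal_def zero_family_def)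
  have c: "char_fun X (space X - E) \<in> S" using E by (auto intro: char_fun_in)
  have "(f \<otimes>\<^bsub>ring_on X S\<^esub> g) \<otimes>\<^bsub>ring_on X S\<^esub> char_fun X (space X - E) \<in> I"
    using f g c by (intro ideal.I_r_closed[OF I]) auto
  moreover have "(f \<otimes>\<^bsub>ring_on X S\<^esub> g) \<otimes>\<^bsub>ring_on X S\<^esub> char_fun X (space X - E)
      = char_fun X (space X - E)"
    using fg by (auto simp: measurable_fun_ring_simps char_fun_def fun_eq_iff indicator_def)
  ultimately show "E \<in> sets X \<and> char_fun X (space X - E) \<in> I" using E by simp
next
  assume E: "E \<in> sets X \<and> char_fun X (space X - E) \<in> I"
  have "char_fun X (space X - E) \<in> S" using E by (auto intro: char_fun_in)
  then have "E \<in> zero_family X S (char_fun X (space X - E))"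
    using E by (auto simp: zero_family_def char_fun_def intro!: bexI[of _ "char_fun X (space X - E)"])
  with E show "E \<in> zero_family_ideal X S I"
    by (auto simp: zero_family_ideal_def)
qed

section \<open>Ultrafilters from prime ideals\<close>

lemma zero_family_ideal_ultrafilter:
  assumes "primeideal P (ring_on X S)"
  shows "sets_ultrafilter X (zero_family_ideal X S P)"
proof -
  interpret P: primeideal P "ring_on X S" by fact
  note P = P.is_ideal
  note iff = zero_family_ideal_iff[OF P]
  have 0: "char_fun X {} \<in> P"
  proof -
    have "char_fun X {} = \<zero>\<^bsub>ring_on X S\<^esub>" by (simp add: char_fun_def measurable_fun_ring_simps)
    then show ?thesis using P.zero_closed by simp
  qed
  have 1: "char_fun X (space X) \<notin> P"
  proof -
    have "char_fun X (space X) = \<one>\<^bsub>ring_on X S\<^esub>"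
      by (auto simp: char_fun_def measurable_fun_ring_simps fun_eq_iff)
    then show ?thesis using P.one_imp_carrier P.I_notcarr by auto
  qed
  have filter: "sets_filter X (zero_family_ideal X S P)"
    unfolding sets_filter_def
  proof (intro conjI ballI impI)
    show "zero_family_ideal X S P \<noteq> {}" using 0 iff[of "space X"] by auto
    show "zero_family_ideal X S P \<subseteq> sets X" using iff by blast
    show "{} \<notin> zero_family_ideal X S P" using 1 iff[of "{}"] by simp
  next
    fix A B assume "A \<in> zero_family_ideal X S P" "B \<in> zero_family_ideal X S P"
    then show "A \<inter> B \<in> zero_family_ideal X S P"
      using ideal_char_fun_Un[OF P, of "space X - A" "space X - B"]
      by (auto simp: iff Diff_Int)
  next
    fix A B assume "A \<in> zero_family_ideal X S P" "B \<in> sets X" "A \<subseteq> B"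
    then show "B \<in> zero_family_ideal X S P"
      using ideal_char_fun_mono[OF P, of "space X - B" "space X - A"]
      by (auto simp: iff)
  qed
  \<comment> \<open>Maximality comes from primality: the characteristic functions of
    \<open>A\<close> and of its complement multiply to zero, so one of them lies in
    \<open>P\<close>. Thus the family contains \<open>A\<close> or its complement, and a strictly
    larger filter would contain both for some \<open>A\<close>.\<close>
  have "G = zero_family_ideal X S P" if G: "sets_filter X G" "zero_family_ideal X S P \<subseteq> G" for G
  proof (rule ccontr)
    assume "G \<noteq> zero_family_ideal X S P"
    with G obtain A where A: "A \<in> G" "A \<notin> zero_family_ideal X S P" by blast
    then have m: "A \<in> sets X" using G by (auto simp: sets_filter_def)
    with A have "char_fun X (space X - A) \<notin> P" by (simp add: iff)
    moreover have "char_fun X (space X - A) \<otimes>\<^bsub>ring_on X S\<^esub> char_fun X A = char_fun X {}"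
      by (auto simp: measurable_fun_ring_simps char_fun_def fun_eq_iff indicator_def)
    moreover have "char_fun X (space X - A) \<in> S" "char_fun X A \<in> S"
      using m by (auto intro: char_fun_in)
    ultimately have "char_fun X A \<in> P"
      using P.I_prime[of "char_fun X (space X - A)" "char_fun X A"] 0 by simp
    moreover have "space X - (space X - A) = A"
      using sets.sets_into_space[OF m] by blast
    ultimately have "space X - A \<in> G" using m G by (auto simp: iff)
    then have "A \<inter> (space X - A) \<in> G" using A sets_filter_Int[OF G(1)] by blast
    then show False using G(1) by (simp add: sets_filter_def)
  qed
  with filter show ?thesis by (simp add: sets_ultrafilter_def)
qed

text \<open>Enlarging \<open>P\<close> to \<open>M\<close> can only enlarge the family, but the
  family of \<open>P\<close> is already a maximal filter.\<close>

lemma zero_family_ideal_prime_subset: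
  assumes P: "primeideal P (ring_on X S)" and M: "maximalideal M (ring_on X S)" and "P \<subseteq> M"
  shows "zero_family_ideal X S M = zero_family_ideal X S P"
proof -
  have "zero_family_ideal X S P \<subseteq> zero_family_ideal X S M"
    using assms(3) by (auto simp: zero_family_ideal_def)
  then show ?thesis
    using zero_family_ideal_ultrafilter[OF P]
      zero_family_ideal_ultrafilter[OF R.maximalideal_prime[OF M]]
    by (auto simp: sets_ultrafilter_def)
qed

section \<open>Vanishing ideals of filters and ultrafilters\<close>

lemma vanishing_ideal_ideal:
  assumes F: "sets_filter X F"
  shows "ideal (vanishing_ideal X S F) (ring_on X S)"
proof -
  let ?V = "vanishing_ideal X S F"
  have mult: "g \<otimes>\<^bsub>ring_on X S\<^esub> f \<in> ?V" if "f \<in> ?V" "g \<in> S" for f g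
  proof -
    have S: "g \<otimes>\<^bsub>ring_on X S\<^esub> f \<in> S"
      using that R.m_closed[of g f] by (simp add: vanishing_ideal_def)
    have "{x \<in> space X. f x = 0} \<subseteq> {x \<in> space X. (g \<otimes>\<^bsub>ring_on X S\<^esub> f) x = 0}"
      by (auto simp: measurable_fun_ring_simps)
    then have "{x \<in> space X. (g \<otimes>\<^bsub>ring_on X S\<^esub> f) x = 0} \<in> F"
      using that(1) sets_filter_mono[OF F _ chi_ring_zero_set[OF S]]
      unfolding vanishing_ideal_def by blast
    with S show ?thesis by (simp add: vanishing_ideal_def)
  qed
  show ?thesis
  proof (rule idealI[OF R.ring_axioms])
    show "subgroup ?V (add_monoid (ring_on X S))"
    proof (rule R.add.subgroupI)
      show "?V \<subseteq> carrier (ring_on X S)" by (auto simp: vanishing_ideal_def)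
      have "\<zero>\<^bsub>ring_on X S\<^esub> \<in> S" using R.zero_closed by simp
      then have "\<zero>\<^bsub>ring_on X S\<^esub> \<in> ?V"
        using sets_filter_space[OF F] by (simp add: vanishing_ideal_def measurable_fun_ring_simps)
      then show "?V \<noteq> {}" by blast
    next
      fix f assume f: "f \<in> ?V"
      then have "f \<in> carrier (ring_on X S)" by (simp add: vanishing_ideal_def)
      \<comment> \<open>Writing negation as multiplication by \<open>\<ominus> \<one>\<close>
        reduces it to \<open>mult\<close>, without a pointwise formula for the additive
        inverse.\<close>
      then have "\<ominus>\<^bsub>ring_on X S\<^esub> f = (\<ominus>\<^bsub>ring_on X S\<^esub> \<one>\<^bsub>ring_on X S\<^esub>) \<otimes>\<^bsub>ring_on X S\<^esub> f"
        by (simp only: R.l_minus[OF R.one_closed] R.l_one)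
      then show "\<ominus>\<^bsub>ring_on X S\<^esub> f \<in> ?V"
        using mult[OF f] R.a_inv_closed[OF R.one_closed] by simp
    next
      fix f g assume fg: "f \<in> ?V" "g \<in> ?V"
      then have S: "f \<oplus>\<^bsub>ring_on X S\<^esub> g \<in> S"
        using R.a_closed[of f g] by (simp add: vanishing_ideal_def)
      have "{x \<in> space X. f x = 0} \<inter> {x \<in> space X. g x = 0} \<in> F"
        using fg sets_filter_Int[OF F] by (simp add: vanishing_ideal_def)
      moreover have "{x \<in> space X. f x = 0} \<inter> {x \<in> space X. g x = 0}
          \<subseteq> {x \<in> space X. (f \<oplus>\<^bsub>ring_on X S\<^esub> g) x = 0}"
        by (auto simp: measurable_fun_ring_simps)
      ultimately have "{x \<in> space X. (f \<oplus>\<^bsub>ring_on X S\<^esub> g) x = 0} \<in> F"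
        using sets_filter_mono[OF F _ chi_ring_zero_set[OF S]] by blast
      with S show "f \<oplus>\<^bsub>ring_on X S\<^esub> g \<in> ?V" by (simp add: vanishing_ideal_def)
    qed
  next
    fix f g assume fg: "f \<in> ?V" "g \<in> carrier (ring_on X S)"
    then show "g \<otimes>\<^bsub>ring_on X S\<^esub> f \<in> ?V" using mult by simp
    moreover have "f \<in> carrier (ring_on X S)" using fg by (simp add: vanishing_ideal_def)
    ultimately show "f \<otimes>\<^bsub>ring_on X S\<^esub> g \<in> ?V" using R.m_comm[of f g] fg by simp
  qed
qed

lemma sets_ultrafilter_Un:
  assumes U: "sets_ultrafilter X U" and AB: "A \<in> sets X" "B \<in> sets X" "A \<union> B \<in> U"
  shows "A \<in> U \<or> B \<in> U"
proof (rule disjCI)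
  note F = sets_ultrafilter_is_filter[OF U]
  assume B: "B \<notin> U"
  \<comment> \<open>This is the filter generated by \<open>U\<close> and the complement of
    \<open>B\<close>; the condition \<open>{} \<notin> G\<close> says exactly that
    \<open>B \<notin> U\<close>.\<close>
  define G where "G = {E \<in> sets X. E \<union> B \<in> U}"
  have "sets_filter X G"
    unfolding sets_filter_def
  proof (intro conjI ballI impI)
    show "G \<noteq> {}" using AB by (auto simp: G_def)
    show "G \<subseteq> sets X" "{} \<notin> G" using B by (auto simp: G_def)
  next
    fix C D assume "C \<in> G" "D \<in> G"
    then show "C \<inter> D \<in> G"
      using sets_filter_Int[OF F, of "C \<union> B" "D \<union> B"] by (auto simp: G_def Un_Int_distrib2)
  next
    fix C D assume "C \<in> G" "D \<in> sets X" "C \<subseteq> D"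
    then show "D \<in> G"
      using sets_filter_mono[OF F, of "C \<union> B" "D \<union> B"] AB by (auto simp: G_def)
  qed
  moreover have "U \<subseteq> G"
  proof
    fix C assume C: "C \<in> U"
    then have "C \<in> sets X" using F by (auto simp: sets_filter_def)
    then show "C \<in> G" using C sets_filter_mono[OF F C, of "C \<union> B"] AB by (auto simp: G_def)
  qed
  ultimately have "G = U" using U by (simp add: sets_ultrafilter_def)
  then show "A \<in> U" using AB by (auto simp: G_def)
qed

text \<open>Since the reals have no zero divisors, the zero set of a product is the union of the
  zero sets, and an ultrafilter containing a union of two measurable sets contains one of
  them.\<close>

lemma vanishing_ideal_prime:
  assumes U: "sets_ultrafilter X U"
  shows "primeideal (vanishing_ideal X S U) (ring_on X S)"
proof (rule primeidealI[OF vanishing_ideal_ideal[OF sets_ultrafilter_is_filter[OF U]] chi_ring_cring])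
  have "{x \<in> space X. \<one>\<^bsub>ring_on X S\<^esub> x = 0} = {}" by (auto simp: measurable_fun_ring_simps)
  then have "\<one>\<^bsub>ring_on X S\<^esub> \<notin> vanishing_ideal X S U"
    using U by (auto simp: vanishing_ideal_def sets_ultrafilter_def sets_filter_def)
  then show "carrier (ring_on X S) \<noteq> vanishing_ideal X S U" using R.one_closed by metis
next
  fix f g assume f: "f \<in> carrier (ring_on X S)" and g: "g \<in> carrier (ring_on X S)"
    and fg: "f \<otimes>\<^bsub>ring_on X S\<^esub> g \<in> vanishing_ideal X S U"
  have "{x \<in> space X. (f \<otimes>\<^bsub>ring_on X S\<^esub> g) x = 0}
      = {x \<in> space X. f x = 0} \<union> {x \<in> space X. g x = 0}"
    by (auto simp: measurable_fun_ring_simps)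
  with fg have "{x \<in> space X. f x = 0} \<union> {x \<in> space X. g x = 0} \<in> U"
    by (simp add: vanishing_ideal_def)
  with sets_ultrafilter_Un[OF U] f g chi_ring_zero_set
  show "f \<in> vanishing_ideal X S U \<or> g \<in> vanishing_ideal X S U"
    by (simp add: vanishing_ideal_def)
qed

text \<open>Each \<open>f\<close> absorbs the characteristic function of the set where it is
  nonzero. If the zero set of \<open>f\<close> is in the family, that characteristic function is in
  \<open>I\<close>, and hence so is \<open>f\<close>.\<close>

lemma vanishing_ideal_zero_family_ideal_subset:
  assumes I: "ideal I (ring_on X S)"
  shows "vanishing_ideal X S (zero_family_ideal X S I) \<subseteq> I"
proof
  fix f assume "f \<in> vanishing_ideal X S (zero_family_ideal X S I)"
  then have f: "f \<in> S" and c: "char_fun X (space X - {x \<in> space X. f x = 0}) \<in> I"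
    by (simp_all add: vanishing_ideal_def zero_family_ideal_iff[OF I])
  have "f \<otimes>\<^bsub>ring_on X S\<^esub> char_fun X (space X - {x \<in> space X. f x = 0}) = f"
    \<comment> \<open>Outside \<open>space X\<close> the product is \<open>undefined\<close>;
      extensionality gives \<open>f\<close> the same value there.\<close>
    using chi_ring_extensional[OF f]
    by (auto simp: measurable_fun_ring_simps char_fun_def fun_eq_iff extensional_def indicator_def)
  with ideal.I_l_closed[OF I c, of f] f show "f \<in> I" by simp
qed

section \<open>The two implications\<close>

lemma gelfand_if_inj_on:
  assumes inj: "inj_on (zero_family_ideal X S) {M. maximalideal M (ring_on X S)}"
  shows "gelfand_ring (ring_on X S)"
  unfolding gelfand_ring_def
proof (intro conjI allI impI chi_ring_cring)
  fix P assume P: "primeideal P (ring_on X S)"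
  then obtain M where M: "maximalideal M (ring_on X S)" "P \<subseteq> M"
    by (rule R.prime_ideal_in_maximalideal)
  have "N = M" if "maximalideal N (ring_on X S)" "P \<subseteq> N" for N
    \<comment> \<open>Both \<open>M\<close> and \<open>N\<close> have the family of
      \<open>P\<close>, so injectivity identifies them.\<close>
    using zero_family_ideal_prime_subset[OF P] M that inj_onD[OF inj] by simp
  with M show "\<exists>!M. maximalideal M (ring_on X S) \<and> P \<subseteq> M" by blast
qed

lemma inj_on_if_gelfand:
  assumes gelfand: "gelfand_ring (ring_on X S)"
  shows "inj_on (zero_family_ideal X S) {M. maximalideal M (ring_on X S)}"
proof (rule inj_onI, clarify)
  fix M N assume M: "maximalideal M (ring_on X S)" and N: "maximalideal N (ring_on X S)"
    and eq: "zero_family_ideal X S M = zero_family_ideal X S N"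
  let ?P = "vanishing_ideal X S (zero_family_ideal X S M)"
  have "primeideal ?P (ring_on X S)"
    using M by (intro vanishing_ideal_prime zero_family_ideal_ultrafilter R.maximalideal_prime)
  moreover have "?P \<subseteq> M" "?P \<subseteq> N"
    \<comment> \<open>By \<open>eq\<close>, \<open>?P\<close> is also the vanishing ideal built from
      \<open>N\<close>, which gives the second inclusion.\<close>
    using vanishing_ideal_zero_family_ideal_subset maximalideal.axioms(1) M N eq by metis+
  ultimately show "M = N" using gelfand M N unfolding gelfand_ring_def by blast
qed

lemma zero_family_ideal_funcset:
  "zero_family_ideal X S \<in> {M. maximalideal M (ring_on X S)} \<rightarrow> {U. sets_ultrafilter X U}"
  using zero_family_ideal_ultrafilter R.maximalideal_prime by blast

end

theorem theorem2p9:
  fixes X :: "'a measure" and S :: "('a \<Rightarrow> real) set"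
  assumes "space X \<noteq> {}" and "chi_ring X S"
  shows "zero_family_ideal X S \<in> {M. maximalideal M (ring_on X S)} \<rightarrow> {U. sets_ultrafilter X U}
    \<and> (inj_on (zero_family_ideal X S) {M. maximalideal M (ring_on X S)}
        \<longleftrightarrow> gelfand_ring (ring_on X S))"
  using zero_family_ideal_funcset[OF assms(2)] gelfand_if_inj_on[OF assms(2)]
    inj_on_if_gelfand[OF assms(2)] by blast

end
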